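(* Let $W,\lambda,T_C,E_C,D>0$ and let $n\ge1$ be an integer. Consider minimizing $$\sum_{i=1}^n (w_is_i^2+E_C)\left(1+\lambda\left(\frac{w_i}{s_i}+T_C\right)\right)$$ over $w_1,\dots,w_n>0$ with $\sum_i w_i=W$ and $s_1,\dots,s_n>0$, subject to $$\sum_{i=1}^n\left(\frac{w_i}{s_i}+T_C\right)+\lambda\sum_{i=1}^n\left(\frac{w_i}{s_i}+T_C\right)^2\le D.$$ In any optimal solution, all chunks have equal size $w_i=W/n$ and all speeds $s_i$ are equal.
   Context: This is the divisible-workload, single-speed model with an expected deadline. A workload $W$ is split into $n$ chunks of sizes $w_i$. Chunk $i$ is executed at speed $s_i$ and, in case of failure, re-executed once at the same speed $s_i$. $\lambda$ is the failure rate, $T_C$ the checkpoint time, and $E_C$ the checkpoint energy. *)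

theory Defs
  imports Complex_Main
begin

text \<open>
  Chunks are indexed by \<open>1, \<dots>, n\<close>; values of \<open>w\<close> and \<open>s\<close> outside this range are irrelevant.
\<close>

text \<open>
  Duration of one execution of a chunk of size \<open>x\<close> at speed \<open>\<sigma>\<close>, checkpoint included.
  Its failure probability is taken to first order, as \<open>lam * chunk_time T\<^sub>C x \<sigma>\<close>, and a failed
  chunk is re-executed once at the same speed; this is where the factor
  \<open>1 + lam * chunk_time T\<^sub>C x \<sigma>\<close> and the quadratic term below come from.
\<close>

definition chunk_time :: "real \<Rightarrow> real \<Rightarrow> real \<Rightarrow> real" where
  "chunk_time T\<^sub>C x \<sigma> = x / \<sigma> + T\<^sub>C"

definition expected_energy ::
  "real \<Rightarrow> real \<Rightarrow> real \<Rightarrow> nat \<Rightarrow> (nat \<Rightarrow> real) \<Rightarrow> (nat \<Rightarrow> real) \<Rightarrow> real" where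
  "expected_energy lam T\<^sub>C E\<^sub>C n w s =
     (\<Sum>i = 1..n. (w i * (s i)\<^sup>2 + E\<^sub>C) * (1 + lam * chunk_time T\<^sub>C (w i) (s i)))"

definition expected_time ::
  "real \<Rightarrow> real \<Rightarrow> nat \<Rightarrow> (nat \<Rightarrow> real) \<Rightarrow> (nat \<Rightarrow> real) \<Rightarrow> real" where
  "expected_time lam T\<^sub>C n w s =
     (\<Sum>i = 1..n. chunk_time T\<^sub>C (w i) (s i)) + lam * (\<Sum>i = 1..n. (chunk_time T\<^sub>C (w i) (s i))\<^sup>2)"

definition feasible ::
  "real \<Rightarrow> real \<Rightarrow> real \<Rightarrow> real \<Rightarrow> nat \<Rightarrow> (nat \<Rightarrow> real) \<Rightarrow> (nat \<Rightarrow> real) \<Rightarrow> bool" where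
  "feasible W lam T\<^sub>C D n w s \<longleftrightarrow>
     (\<forall>i\<in>{1..n}. 0 < w i) \<and> (\<Sum>i = 1..n. w i) = W \<and> (\<forall>i\<in>{1..n}. 0 < s i) \<and>
     expected_time lam T\<^sub>C n w s \<le> D"

end

theory Submission
  imports Defs
begin

text \<open>
  In the variables \<open>w\<close> and \<open>t = w / s\<close> the energy of a chunk is a positive combination of
  \<open>w\<^sup>3 / t\<^sup>2\<close>, \<open>w\<^sup>3 / t\<close>, \<open>t\<close> and a constant. The first is convex, being the perspective of the
  cube, and the second is strictly convex; the expected time is convex in \<open>t\<close>. Replacing every
  \<open>(w\<^sub>i, t\<^sub>i)\<close> by the mean pair hence preserves feasibility and strictly decreases the energy
  unless all pairs already coincide. Convexity is used through tangent inequalities at the mean,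
  whose linear terms cancel upon summation.
\<close>

text \<open>The AM-GM inequality for \<open>w\<^sup>3\<close>, \<open>a u\<^sup>2\<close>, \<open>a\<^sup>2 u\<close> with its equality case, free of cube roots.\<close>

lemma amgm3_pos:
  fixes w u a :: real
  assumes "w > 0" "u > 0" "a > 0" "w \<noteq> a \<or> u \<noteq> a"
  shows "3 * a * w * u < w^3 + a * u\<^sup>2 + a\<^sup>2 * u"
proof -
  let ?Q = "w^3 + a * u\<^sup>2 + a\<^sup>2 * u - 3 * a * w * u"
  \<comment> \<open>Completing the square in \<open>u\<close>; the last term is minus the
    discriminant and is positive for \<open>a < 4 * w\<close>, \<open>w \<noteq> a\<close>.\<close>
  have sq: "4 * a * ?Q = (2 * a * u + a\<^sup>2 - 3 * a * w)\<^sup>2 + a * (a - w)\<^sup>2 * (4 * w - a)"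
    by algebra
  have "?Q > 0"
  proof (cases "w = a")
    case True
    have "?Q = a * (u - a)\<^sup>2"
      unfolding True by algebra
    moreover have "u \<noteq> a"
      using assms(4) True by simp
    ultimately show ?thesis
      using assms(3) by simp
  next
    case False
    show ?thesis
    proof (cases "a < 4 * w")
      case True
      then have "0 < a * (a - w)\<^sup>2 * (4 * w - a)"
        using False assms(3) by simp
      then have "0 < 4 * a * ?Q"
        unfolding sq by (simp add: add_nonneg_pos)
      then show ?thesis
        using assms(3) by (simp add: zero_less_mult_iff)
    next
      case False
      \<comment> \<open>Now \<open>4 * w \<le> a\<close>, so even the coefficient of
        \<open>u\<close> in \<open>?Q\<close> is nonnegative.\<close>
      then have "0 \<le> a * u * (a - 3 * w)"
        using assms by simp
      moreover have "?Q = w^3 + a * u\<^sup>2 + a * u * (a - 3 * w)"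
        by algebra
      moreover have "0 < w^3" "0 < a * u\<^sup>2"
        using assms by simp_all
      ultimately show ?thesis
        by linarith
    qed
  qed
  then show ?thesis by simp
qed

definition chunk_energy :: "real \<Rightarrow> real \<Rightarrow> real \<Rightarrow> real \<Rightarrow> real \<Rightarrow> real" where
  "chunk_energy lam T E x \<sigma> = (x * \<sigma>\<^sup>2 + E) * (1 + lam * chunk_time T x \<sigma>)"

text \<open>The coefficients of \<open>w - a\<close> and \<open>w / s - a / \<sigma>\<close> are the partial derivatives of the energy
  with respect to \<open>w\<close> and \<open>t = w / s\<close> at the chunk \<open>(a, \<sigma>)\<close>.\<close>

lemma chunk_energy_tangent:
  fixes w s a \<sigma> lam T E :: real
  assumes pos: "w > 0" "s > 0" "a > 0" "\<sigma> > 0" and "lam > 0" "T > 0"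
    and ne: "w \<noteq> a \<or> s \<noteq> \<sigma>"
  shows "chunk_energy lam T E a \<sigma>
      + (3 * (1 + lam * T) * \<sigma>\<^sup>2 + 3 * lam * \<sigma> * a) * (w - a)
      + (lam * E - 2 * (1 + lam * T) * \<sigma>^3 - lam * \<sigma>\<^sup>2 * a) * (w / s - a / \<sigma>)
    < chunk_energy lam T E w s"
    (is "?L < ?R")
proof -
  define t b where "t = w / s" and "b = a / \<sigma>"
  have t: "t > 0" "w = s * t" and b: "a = \<sigma> * b"
    using pos by (simp_all add: t_def b_def)
  \<comment> \<open>\<open>?P\<close> and \<open>?S\<close> are the gaps between
    \<open>w^3 / t^2\<close>, \<open>w^3 / t\<close> and their tangent planes at
    \<open>(a, b)\<close>.\<close>
  let ?P = "s^3 * t - 3 * \<sigma>\<^sup>2 * (s * t) + 2 * \<sigma>^3 * t"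
  let ?S = "s^3 * t\<^sup>2 - 3 * \<sigma> * a * (s * t) + \<sigma>\<^sup>2 * a * t + \<sigma> * a\<^sup>2"
  have "?P = t * (s - \<sigma>)\<^sup>2 * (s + 2 * \<sigma>)"
    by algebra
  then have P: "?P \<ge> 0"
    using t pos by simp
  \<comment> \<open>AM-GM is applied with \<open>u = \<sigma> * t\<close>: equality would force
    \<open>s * t = a = \<sigma> * t\<close>, hence \<open>s = \<sigma>\<close>.\<close>
  have "w \<noteq> a \<or> \<sigma> * t \<noteq> a"
    using ne t pos by auto
  from amgm3_pos[OF pos(1) _ pos(3) this]
  have "3 * a * w * (\<sigma> * t) < w^3 + a * (\<sigma> * t)\<^sup>2 + a\<^sup>2 * (\<sigma> * t)"
    using pos t by simp
  moreover have "t * ?S = w^3 + a * (\<sigma> * t)\<^sup>2 + a\<^sup>2 * (\<sigma> * t) - 3 * a * w * (\<sigma> * t)"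
    unfolding t(2) by algebra
  ultimately have "0 < t * ?S"
    by simp
  then have S: "0 < ?S"
    using t(1) by (simp add: zero_less_mult_iff)
  have "?R - ?L = (1 + lam * T) * ?P + lam * ?S"
    unfolding chunk_energy_def chunk_time_def t_def[symmetric] b_def[symmetric]
    unfolding t(2) b by algebra
  moreover have "0 \<le> (1 + lam * T) * ?P"
    using P assms by simp
  moreover have "0 < lam * ?S"
    using S assms by simp
  ultimately show ?thesis
    by linarith
qed

text \<open>The squared deviations from the mean have a nonnegative sum. This bounds the quadratic
  part of the expected time under averaging.\<close>

lemma sum_squares_ge_mean:
  fixes x :: "'a \<Rightarrow> real"
  assumes "(\<Sum>i\<in>A. x i) = real (card A) * m"
  shows "real (card A) * m\<^sup>2 \<le> (\<Sum>i\<in>A. (x i)\<^sup>2)"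
proof -
  have "0 \<le> (\<Sum>i\<in>A. (x i - m)\<^sup>2)"
    by (simp add: sum_nonneg)
  also have "\<dots> = (\<Sum>i\<in>A. (x i)\<^sup>2) - 2 * m * (\<Sum>i\<in>A. x i) + real (card A) * m\<^sup>2"
    by (simp add: power2_diff sum.distrib sum_subtractf sum_distrib_left sum_distrib_right mult_ac)
  also have "\<dots> = (\<Sum>i\<in>A. (x i)\<^sup>2) - real (card A) * m\<^sup>2"
    unfolding assms by algebra
  finally show ?thesis by simp
qed

theorem theorem1:
  fixes W lam T\<^sub>C E\<^sub>C D :: real and n :: nat and w s :: "nat \<Rightarrow> real"
  assumes "W > 0" and "lam > 0" and "T\<^sub>C > 0" and "E\<^sub>C > 0" and "D > 0" and "n \<ge> 1"
    and "is_arg_min (\<lambda>(w, s). expected_energy lam T\<^sub>C E\<^sub>C n w s)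
           (\<lambda>(w, s). feasible W lam T\<^sub>C D n w s) (w, s)"
  shows "(\<forall>i\<in>{1..n}. w i = W / real n) \<and> (\<forall>i\<in>{1..n}. \<forall>j\<in>{1..n}. s i = s j)"
proof -
  let ?I = "{1..n}"
  define a where "a = W / real n"
  define \<tau> where "\<tau> = (\<Sum>i\<in>?I. w i / s i)"
  \<comment> \<open>Chosen so that \<open>a / \<sigma>\<close> is the mean of the
    \<open>w i / s i\<close>; thus \<open>\<sigma>\<close> averages durations, not speeds.\<close>
  define \<sigma> where "\<sigma> = W / \<tau>"
  have feas: "feasible W lam T\<^sub>C D n w s"
    using assms(7) by (simp add: is_arg_min_def)
  have opt: "\<not> expected_energy lam T\<^sub>C E\<^sub>C n w' s' < expected_energy lam T\<^sub>C E\<^sub>C n w s"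
      if "feasible W lam T\<^sub>C D n w' s'" for w' s'
    using assms(7) that by (auto simp: is_arg_min_def)
  have w: "\<And>i. i \<in> ?I \<Longrightarrow> 0 < w i" and s: "\<And>i. i \<in> ?I \<Longrightarrow> 0 < s i"
    and W: "(\<Sum>i\<in>?I. w i) = W" and D: "expected_time lam T\<^sub>C n w s \<le> D"
    using feas by (auto simp: feasible_def)
  have n: "real n > 0"
    using assms(6) by simp
  have "\<tau> > 0"
    unfolding \<tau>_def using w s assms(6) by (intro sum_pos) auto
  have a: "a > 0" and \<sigma>: "\<sigma> > 0" and na: "real n * a = W" and nt: "real n * (a / \<sigma>) = \<tau>"
    using assms(1) n \<open>\<tau> > 0\<close> by (simp_all add: a_def \<sigma>_def)

  have time: "(\<Sum>i\<in>?I. chunk_time T\<^sub>C (w i) (s i)) = real (card ?I) * chunk_time T\<^sub>C a \<sigma>"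
    using nt by (simp add: chunk_time_def sum.distrib \<tau>_def distrib_left)
  have "expected_time lam T\<^sub>C n (\<lambda>_. a) (\<lambda>_. \<sigma>) \<le> expected_time lam T\<^sub>C n w s"
    using time sum_squares_ge_mean[OF time] assms(2) by (simp add: expected_time_def)
  then have "feasible W lam T\<^sub>C D n (\<lambda>_. a) (\<lambda>_. \<sigma>)"
    using D a \<sigma> na by (simp add: feasible_def)
  then have le: "expected_energy lam T\<^sub>C E\<^sub>C n w s \<le> real n * chunk_energy lam T\<^sub>C E\<^sub>C a \<sigma>"
    using opt by (force simp: expected_energy_def chunk_energy_def)

  define \<alpha> where "\<alpha> = 3 * (1 + lam * T\<^sub>C) * \<sigma>\<^sup>2 + 3 * lam * \<sigma> * a"
  define \<beta> where "\<beta> = lam * E\<^sub>C - 2 * (1 + lam * T\<^sub>C) * \<sigma>^3 - lam * \<sigma>\<^sup>2 * a"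
  define L where "L i = chunk_energy lam T\<^sub>C E\<^sub>C a \<sigma> + \<alpha> * (w i - a) + \<beta> * (w i / s i - a / \<sigma>)" for i
  have tangent: "L i < chunk_energy lam T\<^sub>C E\<^sub>C (w i) (s i)"
    if "i \<in> ?I" "w i \<noteq> a \<or> s i \<noteq> \<sigma>" for i
    unfolding L_def \<alpha>_def \<beta>_def
    using chunk_energy_tangent[OF w[OF that(1)] s[OF that(1)] a \<sigma> assms(2,3) that(2)] .
  have "(\<Sum>i\<in>?I. w i - a) = 0" "(\<Sum>i\<in>?I. w i / s i - a / \<sigma>) = 0"
    using W na nt by (simp_all add: sum_subtractf \<tau>_def)
  then have sumL: "(\<Sum>i\<in>?I. L i) = real n * chunk_energy lam T\<^sub>C E\<^sub>C a \<sigma>"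
    by (simp add: L_def sum.distrib flip: sum_distrib_left)
  have "w i = a \<and> s i = \<sigma>" if i: "i \<in> ?I" for i
  proof (rule ccontr)
    assume "\<not> (w i = a \<and> s i = \<sigma>)"
    then have "L i < chunk_energy lam T\<^sub>C E\<^sub>C (w i) (s i)"
      using tangent i by blast
    \<comment> \<open>A chunk equal to the mean pair gives equality, so one deviating chunk suffices
      for a strict sum, against \<open>le\<close>.\<close>
    moreover have "L j \<le> chunk_energy lam T\<^sub>C E\<^sub>C (w j) (s j)" if "j \<in> ?I" for j
      using tangent[OF that] by (cases "w j = a \<and> s j = \<sigma>") (auto simp: L_def)
    ultimately have "(\<Sum>i\<in>?I. L i) < (\<Sum>i\<in>?I. chunk_energy lam T\<^sub>C E\<^sub>C (w i) (s i))"
      using i by (intro sum_strict_mono_ex1) auto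
    then show False
      using le sumL by (simp add: expected_energy_def chunk_energy_def)
  qed
  then show ?thesis
    by (simp add: a_def)
qed

end
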